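(* If a graph embedding $G$ with at least two edges has a separating vertex/face pair, a separating loop, or a separating coloop, then every partial dual of $G$ has a separating vertex/face pair. Hence, no partial dual of $G$ is closed $2$-cell.
   Context: Graphs are finite and may have loops and multiple edges. A surface is a connected compact $2$-manifold without boundary. All graph embeddings are $2$-cell embeddings (every face is an open disk) of connected graphs in surfaces $\Sigma$. An embedding is closed $2$-cell if the boundary walk of every face is a cycle in the graph. Separating vertex/face pair: a pair $(v,f)$, $v$ a vertex and $f$ a face, such that there is a simple closed curve $\Psi\subseteq f\cup\{v\}$ through $v$ that separates $\Sigma$ into two components, each containing at least one edge of $G$ (minus possibly its endpoint $v$). (Equivalently, in the gem of $G$, the properly $3$-edge-coloured cubic graph dual to the barycentric subdivision in which red-yellow, red-blue, blue-yellow bigons correspond to the vertices, edges, faces of $G$, there is a $2$-edge cut consisting of two yellow edges that both lie on the red-yellow bigon of $v$ and on the blue-yellow bigon of $f$.) In particular $v$ and $f$ are then incident more than once. Separating loop: an edge $e$ that is a loop of $G$ and that, as a simple closed curve, separates $\Sigma$. Separating coloop: an edge $e$ of $G$ whose dual edge $e^*$ is a separating loop of the geometric dual embedding $G^*$ (so $e$ has the same face on both sides and is a cutedge of $G$). Partial dual $G^D$ for $D\subseteq E(G)$: represent $G$ by a ribbon graph $O$, i.e. a union of closed disks $\overline{c_v}$, $v\in V(G)$ ($0$-bands, fattened vertices) and $\overline{q_e}$, $e\in E(G)$ ($1$-bands, fattened edges, each attached to the $0$-bands along two opposite boundary arcs), from which the embedding is recovered by gluing a disk along each boundary component. Let $\Delta$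 be the ribbon subgraph consisting of all $\overline{c_v}$, $v\in V(G)$, and $\overline{q_e}$, $e\in D$, with boundary components $C'_1,\dots,C'_k$. Add to $O$ a new $0$-band $\overline{c'_i}$ with boundary $C'_i$ for each $i$, and then remove every old $0$-band interior $c_v$. The result is a ribbon graph with $0$-bands $\overline{c'_i}$ and $1$-bands $\overline{q_e}$; the embedding it represents is $G^D$. A partial dual of $G$ is any $G^D$ with $D\subseteq E(G)$. *)

theory Defs
  imports Main
begin

text \<open>
  A 2-cell embedding of a connected graph (with at least one edge) in a surface is represented by
  its gem. The barycentric subdivision cuts the surface into triangles, the flags, whose
  corners are a vertex, the midpoint of an edge and the centre of a face. The neighbour of a flag
  across the side joining the vertex to the edge midpoint is its \<open>Red\<close> neighbour (the face
  changes), across the side joining the edge midpoint to the face centre its \<open>Blue\<close> neighbour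
  (the vertex changes), and across the side joining the vertex to the face centre its
  \<open>Yellow\<close> neighbour (the edge changes). Finite systems of triangles glued in this way are exactly
  the graph embeddings, up to homeomorphism. The surface need not be orientable.

  In the ribbon graph, the flags are the corners of the rectangular 1-bands; a red gem edge is an
  arc along which a 1-band is attached to a 0-band, a blue gem edge is a free side of a 1-band,
  and a yellow gem edge is an arc of the boundary of a 0-band between two consecutive attachments.
\<close>

datatype colour = Red | Yellow | Blue

record 'a gem =
  flags :: "'a set"
  adj :: "colour \<Rightarrow> 'a \<Rightarrow> 'a"

text \<open>The colour is part of a gem edge, since gem edges of distinct colours may be parallel.\<close>

definition gem_edge :: "'a gem \<Rightarrow> colour \<Rightarrow> 'a \<Rightarrow> colour \<times> 'a set" where
  "gem_edge G c x = (c, {x, adj G c x})"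

definition gem_edges :: "'a gem \<Rightarrow> (colour \<times> 'a set) set" where
  "gem_edges G = {gem_edge G c x | c x. x \<in> flags G}"

definition coloured_edges :: "'a gem \<Rightarrow> colour set \<Rightarrow> (colour \<times> 'a set) set" where
  "coloured_edges G C = {k \<in> gem_edges G. fst k \<in> C}"

definition links :: "'a gem \<Rightarrow> (colour \<times> 'a set) set \<Rightarrow> 'a rel" where
  "links G K = {(x, adj G c x) | c x. x \<in> flags G \<and> gem_edge G c x \<in> K}"

definition component_of :: "'a gem \<Rightarrow> (colour \<times> 'a set) set \<Rightarrow> 'a \<Rightarrow> 'a set" where
  "component_of G K x = (links G K)\<^sup>* `` {x}"

text \<open>The (flag sets of the) components of the spanning subgraph of the gem with edge set \<open>K\<close>.\<close>

definition gem_components :: "'a gem \<Rightarrow> (colour \<times> 'a set) set \<Rightarrow> 'a set set" where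
  "gem_components G K = component_of G K ` flags G"

definition vertices :: "'a gem \<Rightarrow> 'a set set" where
  "vertices G = gem_components G (coloured_edges G {Red, Yellow})"

definition edges :: "'a gem \<Rightarrow> 'a set set" where
  "edges G = gem_components G (coloured_edges G {Red, Blue})"

definition faces :: "'a gem \<Rightarrow> 'a set set" where
  "faces G = gem_components G (coloured_edges G {Blue, Yellow})"

definition graph_embedding :: "'a gem \<Rightarrow> bool" where
  "graph_embedding G \<longleftrightarrow>
     finite (flags G) \<and>
     (\<forall>c. \<forall>x\<in>flags G. adj G c x \<in> flags G \<and> adj G c x \<noteq> x \<and> adj G c (adj G c x) = x) \<and>
     (\<forall>e\<in>edges G. card e = 4) \<and>
     gem_components G (gem_edges G) = {flags G}"

text \<open>
  Removing from the surface a closed curve that runs along sides of flags leaves the flags glued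
  along their remaining sides. Hence the components of its complement are the components of the
  gem after deletion of the gem edges dual to these sides.

  Up to isotopy, a simple closed curve in \<open>f \<union> {v}\<close> through \<open>v\<close> leaves \<open>v\<close> through
  one corner of \<open>f\<close> at \<open>v\<close>, passes through the centre of \<open>f\<close>, and returns through a corner of
  \<open>f\<close> at \<open>v\<close>; a corner is a yellow gem edge on both bigons. If the two corners coincide, the
  curve bounds a disk without edges, so only distinct corners matter.
\<close>

definition separating_vertex_face_pair :: "'a gem \<Rightarrow> 'a set \<Rightarrow> 'a set \<Rightarrow> bool" where
  "separating_vertex_face_pair G v f \<longleftrightarrow>
     v \<in> vertices G \<and> f \<in> faces G \<and>
     (\<exists>x y. x \<in> v \<inter> f \<and> y \<in> v \<inter> f \<and> gem_edge G Yellow x \<noteq> gem_edge G Yellow y \<and>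
       (\<exists>A B. A \<noteq> B \<and>
          gem_components G (gem_edges G - {gem_edge G Yellow x, gem_edge G Yellow y}) = {A, B} \<and>
          (\<exists>e\<in>edges G. e \<subseteq> A) \<and> (\<exists>e\<in>edges G. e \<subseteq> B)))"

definition is_loop :: "'a gem \<Rightarrow> 'a set \<Rightarrow> bool" where
  "is_loop G e \<longleftrightarrow> e \<in> edges G \<and> (\<exists>!v. v \<in> vertices G \<and> v \<inter> e \<noteq> {})"

text \<open>The edge \<open>e\<close> itself runs along the sides dual to the two red gem edges of its bigon.\<close>

definition separating_loop :: "'a gem \<Rightarrow> 'a set \<Rightarrow> bool" where
  "separating_loop G e \<longleftrightarrow>
     is_loop G e \<and> card (gem_components G (gem_edges G - gem_edge G Red ` e)) \<ge> 2"

text \<open>The geometric dual exchanges the corners of the flags at vertices and at face centres.\<close>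

definition dual :: "'a gem \<Rightarrow> 'a gem" where
  "dual G = \<lparr>flags = flags G,
     adj = (\<lambda>c. adj G (case c of Red \<Rightarrow> Blue | Yellow \<Rightarrow> Yellow | Blue \<Rightarrow> Red))\<rparr>"

text \<open>As a set of flags, the dual edge of \<open>e\<close> is \<open>e\<close>.\<close>

definition separating_coloop :: "'a gem \<Rightarrow> 'a set \<Rightarrow> bool" where
  "separating_coloop G e \<longleftrightarrow> e \<in> edges G \<and> separating_loop (dual G) e"

text \<open>
  The ribbon subgraph consisting of all 0-bands and the 1-bands in \<open>D\<close> is bounded by all yellow
  arcs, by the free sides of the 1-bands in \<open>D\<close>, and by the arcs to which the deleted 1-bands
  were attached. In the partial dual, each of its boundary components bounds a new 0-band, so the
  arcs of a 1-band that lie on this boundary are now its attaching arcs (red) and its other two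
  arcs are now free (blue).
\<close>

definition subribbon_boundary :: "'a gem \<Rightarrow> 'a set set \<Rightarrow> (colour \<times> 'a set) set" where
  "subribbon_boundary G D =
     coloured_edges G {Yellow}
     \<union> {gem_edge G Blue x | x. x \<in> \<Union>D}
     \<union> {gem_edge G Red x | x. x \<in> flags G - \<Union>D}"

definition partial_dual :: "'a gem \<Rightarrow> 'a set set \<Rightarrow> 'a gem" where
  "partial_dual G D = \<lparr>flags = flags G,
     adj = (\<lambda>c x. case c of
         Yellow \<Rightarrow> adj G Yellow x
       | Red \<Rightarrow> (if gem_edge G Blue x \<in> subribbon_boundary G D then adj G Blue x else adj G Red x)
       | Blue \<Rightarrow> (if gem_edge G Blue x \<in> subribbon_boundary G D then adj G Red x else adj G Blue x))\<rparr>"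

text \<open>
  With this recolouring, the vertices of the partial dual are indeed the boundary components of the
  ribbon subgraph, its edges are those of \<open>G\<close>, and it is again a graph embedding.
\<close>

lemma links_coloured_edges:
  "links G (coloured_edges G C) = {(x, adj G c x) | c x. x \<in> flags G \<and> c \<in> C}"
  by (auto simp: links_def coloured_edges_def gem_edges_def gem_edge_def)

lemma links_gem_edges: "links G (gem_edges G) = {(x, adj G c x) | c x. x \<in> flags G}"
  by (auto simp: links_def gem_edges_def)

lemma edge_closed:
  assumes G: "graph_embedding G" and e: "e \<in> edges G" and x: "x \<in> flags G" and c: "c \<in> {Red, Blue}"
  shows "adj G c x \<in> e \<longleftrightarrow> x \<in> e"
proof -
  let ?R = "links G (coloured_edges G {Red, Blue})"
  from e obtain z where z: "e = ?R\<^sup>* `` {z}"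
    by (auto simp: edges_def gem_components_def component_of_def)
  have step: "(y, adj G c y) \<in> ?R" if "y \<in> flags G" for y
    unfolding links_coloured_edges using that c by blast
  have "adj G c x \<in> flags G" and "adj G c (adj G c x) = x"
    using G x by (auto simp: graph_embedding_def)
  with step[OF x] step[of "adj G c x"]
  have "(x, adj G c x) \<in> ?R" and "(adj G c x, x) \<in> ?R"
    by simp_all
  then show ?thesis
    unfolding z by (auto intro: rtrancl_into_rtrancl)
qed

lemma subribbon_boundary_iff:
  assumes G: "graph_embedding G" and D: "D \<subseteq> edges G" and x: "x \<in> flags G"
  shows "gem_edge G Yellow x \<in> subribbon_boundary G D"
    and "gem_edge G Blue x \<in> subribbon_boundary G D \<longleftrightarrow> x \<in> \<Union>D"
    and "gem_edge G Red x \<in> subribbon_boundary G D \<longleftrightarrow> x \<notin> \<Union>D"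
proof -
  have same: "y \<in> \<Union>D \<longleftrightarrow> z \<in> \<Union>D"
    if "gem_edge G c y = gem_edge G c z" "c \<in> {Red, Blue}" "y \<in> flags G" for c y z
  proof -
    have "adj G c y \<in> \<Union>D \<longleftrightarrow> y \<in> \<Union>D"
      using edge_closed[OF G _ that(3,2)] D by blast
    moreover have "z = y \<or> z = adj G c y"
      using that(1) by (auto simp: gem_edge_def doubleton_eq_iff)
    ultimately show ?thesis by blast
  qed
  show "gem_edge G Yellow x \<in> subribbon_boundary G D"
    using x by (auto simp: subribbon_boundary_def coloured_edges_def gem_edges_def gem_edge_def)
  have "gem_edge G Blue x \<in> subribbon_boundary G D \<longleftrightarrow>
        (\<exists>y\<in>\<Union>D. gem_edge G Blue x = gem_edge G Blue y)"
    by (auto simp: subribbon_boundary_def coloured_edges_def gem_edge_def)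
  then show "gem_edge G Blue x \<in> subribbon_boundary G D \<longleftrightarrow> x \<in> \<Union>D"
    using same[of Blue x] x by blast
  have "gem_edge G Red x \<in> subribbon_boundary G D \<longleftrightarrow>
        (\<exists>y\<in>flags G - \<Union>D. gem_edge G Red x = gem_edge G Red y)"
    by (auto simp: subribbon_boundary_def coloured_edges_def gem_edge_def)
  then show "gem_edge G Red x \<in> subribbon_boundary G D \<longleftrightarrow> x \<notin> \<Union>D"
    using same[of Red x] x by blast
qed

lemma adj_partial_dual:
  assumes "graph_embedding G" and "D \<subseteq> edges G" and "x \<in> flags G"
  shows "adj (partial_dual G D) Yellow x = adj G Yellow x"
    and "adj (partial_dual G D) Red x = (if x \<in> \<Union>D then adj G Blue x else adj G Red x)"
    and "adj (partial_dual G D) Blue x = (if x \<in> \<Union>D then adj G Red x else adj G Blue x)"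
  using subribbon_boundary_iff[OF assms] by (simp_all add: partial_dual_def)

lemma flags_partial_dual [simp]: "flags (partial_dual G D) = flags G"
  by (simp add: partial_dual_def)

lemma all_colour: "(\<forall>c. P c) \<longleftrightarrow> P Red \<and> P Yellow \<and> P Blue"
  by (metis colour.exhaust)

lemma ex_colour: "(\<exists>c. P c) \<longleftrightarrow> P Red \<or> P Yellow \<or> P Blue"
  by (metis colour.exhaust)

lemma vertices_partial_dual:
  assumes "graph_embedding G" and "D \<subseteq> edges G"
  shows "vertices (partial_dual G D) = gem_components G (subribbon_boundary G D)"
proof -
  have "links (partial_dual G D) (coloured_edges (partial_dual G D) {Red, Yellow}) =
        links G (subribbon_boundary G D)"
  proof (rule set_eqI, clarify)
    fix x y
    show "(x, y) \<in> links (partial_dual G D) (coloured_edges (partial_dual G D) {Red, Yellow}) \<longleftrightarrow>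
          (x, y) \<in> links G (subribbon_boundary G D)"
    proof (cases "x \<in> flags G")
      case True
      then show ?thesis
        using adj_partial_dual[OF assms True] subribbon_boundary_iff[OF assms True]
        by (cases "x \<in> \<Union>D")
          (simp_all add: links_coloured_edges ex_colour links_def[of G] disj_commute del: Union_iff)
    qed (simp add: links_def)
  qed
  then show ?thesis
    by (simp add: vertices_def gem_components_def component_of_def)
qed

lemma edges_partial_dual:
  assumes "graph_embedding G" and "D \<subseteq> edges G"
  shows "edges (partial_dual G D) = edges G"
proof -
  have "links (partial_dual G D) (coloured_edges (partial_dual G D) {Red, Blue}) =
        links G (coloured_edges G {Red, Blue})"
  proof (rule set_eqI, clarify)
    fix x y
    show "(x, y) \<in> links (partial_dual G D) (coloured_edges (partial_dual G D) {Red, Blue}) \<longleftrightarrow>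
          (x, y) \<in> links G (coloured_edges G {Red, Blue})"
    proof (cases "x \<in> flags G")
      case True
      then show ?thesis
        using adj_partial_dual[OF assms True]
        by (cases "x \<in> \<Union>D")
          (simp_all add: links_coloured_edges ex_colour disj_ac del: Union_iff)
    qed (simp add: links_def)
  qed
  then show ?thesis
    by (simp add: edges_def gem_components_def component_of_def)
qed

lemma graph_embedding_partial_dual:
  assumes "graph_embedding G" and "D \<subseteq> edges G"
  shows "graph_embedding (partial_dual G D)"
proof -
  have "links (partial_dual G D) (gem_edges (partial_dual G D)) = links G (gem_edges G)"
  proof (rule set_eqI, clarify)
    fix x y
    show "(x, y) \<in> links (partial_dual G D) (gem_edges (partial_dual G D)) \<longleftrightarrow>
          (x, y) \<in> links G (gem_edges G)"
    proof (cases "x \<in> flags G")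
      case True
      then show ?thesis
        using adj_partial_dual[OF assms True]
        by (cases "x \<in> \<Union>D")
          (simp_all add: links_gem_edges ex_colour disj_ac del: Union_iff)
    qed (simp add: links_def)
  qed
  then have "gem_components (partial_dual G D) (gem_edges (partial_dual G D)) =
             gem_components G (gem_edges G)"
    by (simp add: gem_components_def component_of_def)
  moreover have "adj G c x \<in> \<Union>D \<longleftrightarrow> x \<in> \<Union>D" if "x \<in> flags G" "c \<in> {Red, Blue}" for c x
    using edge_closed[OF assms(1) _ that] assms(2) by blast
  ultimately show ?thesis
    using assms(1) edges_partial_dual[OF assms] adj_partial_dual[OF assms]
    by (simp add: graph_embedding_def all_colour del: Union_iff)
qed

text \<open>
  Going once around the face containing the flag \<open>x\<close>: cross the current edge to its other end
  (blue), then pass the corner to the next edge (yellow). Listing the flags met gives the boundary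
  walk, starting at the vertex of \<open>x\<close> along the edge of \<open>x\<close>.
\<close>

definition face_step :: "'a gem \<Rightarrow> 'a \<Rightarrow> 'a" where
  "face_step G x = adj G Yellow (adj G Blue x)"

definition boundary_walk :: "'a gem \<Rightarrow> 'a \<Rightarrow> 'a list" where
  "boundary_walk G x =
     map (\<lambda>i. (face_step G ^^ i) x) [0..<(LEAST k. k > 0 \<and> (face_step G ^^ k) x = x)]"

definition vertex_of :: "'a gem \<Rightarrow> 'a \<Rightarrow> 'a set" where
  "vertex_of G = component_of G (coloured_edges G {Red, Yellow})"

definition edge_of :: "'a gem \<Rightarrow> 'a \<Rightarrow> 'a set" where
  "edge_of G = component_of G (coloured_edges G {Red, Blue})"

text \<open>A cycle may have length 1 (a loop) or 2 (two parallel edges).\<close>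

definition closed_two_cell :: "'a gem \<Rightarrow> bool" where
  "closed_two_cell G \<longleftrightarrow>
     (\<forall>x\<in>flags G. distinct (map (vertex_of G) (boundary_walk G x)) \<and>
                   distinct (map (edge_of G) (boundary_walk G x)))"

end

theory Submission imports Defs begin

text \<open>
  Call a union \<open>A\<close> of edge bigons, neither empty nor everything, a narrow cut if at most two yellow
  gem edges leave \<open>A\<close>. Fixed-point-free involutions force the number of yellow gem edges leaving a
  set closed under the red or the blue involution to be even; since the gem is connected, exactly
  two leave a narrow cut. Applied to the parts of \<open>A\<close> inside a bigon or a component, the same parity
  argument shows that narrow cuts are exactly the separating vertex/face pairs. Partial duality only
  exchanges red and blue on some edge bigons, so it preserves narrow cuts. A separating loop or
  coloop yields one as well: remove the flags of the edge from a side that contains further edges. Finally, the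
  boundary walk of a face visits both corners of a separating pair at the same vertex.
\<close>

section \<open>Involutions, components and connectedness of gems\<close>

text \<open>The orbits \<open>{x, h x}\<close> partition \<open>A\<close> into pairs; the induction
  removes one pair at a time.\<close>

lemma even_card_involution:
  assumes "finite A" and "\<And>x. x \<in> A \<Longrightarrow> h x \<in> A \<and> h x \<noteq> x \<and> h (h x) = x"
  shows "even (card A)"
  using assms
proof (induction A rule: finite_psubset_induct)
  case (psubset A)
  show ?case
  proof (cases "A = {}")
    case False
    then obtain x where x: "x \<in> A" by blast
    let ?B = "A - {x, h x}"
    have hx: "h x \<in> A" "h x \<noteq> x" "h (h x) = x" using psubset.prems[OF x] by auto
    have "h y \<in> ?B \<and> h y \<noteq> y \<and> h (h y) = y" if "y \<in> ?B" for y
      using psubset.prems[of y] that hx by auto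
    then have "even (card ?B)"
      using psubset.IH[of ?B] x by blast
    moreover have "card A = card ?B + 2"
    proof -
      have "card {x, h x} = 2" using hx(2) by simp
      moreover have "card ?B = card A - card {x, h x}"
        using x hx by (intro card_Diff_subset) auto
      moreover have "card {x, h x} \<le> card A"
        using x hx psubset.hyps by (intro card_mono) auto
      ultimately show ?thesis by linarith
    qed
    ultimately show ?thesis by simp
  qed simp
qed

lemma graph_embeddingD:
  assumes "graph_embedding G" and "x \<in> flags G"
  shows "adj G c x \<in> flags G" "adj G c x \<noteq> x" "adj G c (adj G c x) = x"
  using assms by (auto simp: graph_embedding_def)

lemma finite_flags: "graph_embedding G \<Longrightarrow> finite (flags G)"
  by (simp add: graph_embedding_def)

lemma gem_edge_adj:
  assumes "graph_embedding G" and "x \<in> flags G"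
  shows "gem_edge G c (adj G c x) = gem_edge G c x"
  using graph_embeddingD[OF assms] by (auto simp: gem_edge_def)

lemma gem_edge_eq_iff:
  assumes "graph_embedding G" and "x \<in> flags G"
  shows "gem_edge G c x = gem_edge G d y \<longleftrightarrow> c = d \<and> (y = x \<or> y = adj G c x)"
  using graph_embeddingD[OF assms] by (auto simp: gem_edge_def doubleton_eq_iff)

lemma component_of_refl: "x \<in> component_of G K x"
  by (simp add: component_of_def)

lemma component_of_least:
  assumes "x \<in> S"
    and "\<And>z c. z \<in> S \<Longrightarrow> z \<in> flags G \<Longrightarrow> gem_edge G c z \<in> K \<Longrightarrow> adj G c z \<in> S"
  shows "component_of G K x \<subseteq> S"
proof
  fix y assume "y \<in> component_of G K x"
  then have "(x, y) \<in> (links G K)\<^sup>*" by (simp add: component_of_def)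
  then show "y \<in> S"
    by (induction rule: rtrancl_induct) (use assms in \<open>auto simp: links_def\<close>)
qed

lemma component_of_subset_flags:
  assumes "graph_embedding G" and "x \<in> flags G"
  shows "component_of G K x \<subseteq> flags G"
  using assms by (intro component_of_least) (auto dest: graph_embeddingD)

text \<open>Since \<open>adj G c\<close> is an involution, a gem edge has the same name at both
  ends, so links can be traversed backwards. Hence components are equivalence classes.\<close>

lemma sym_links:
  assumes G: "graph_embedding G"
  shows "sym (links G K)"
proof (rule symI)
  fix x y assume "(x, y) \<in> links G K"
  then obtain c where "y = adj G c x" "x \<in> flags G" "gem_edge G c x \<in> K"
    by (auto simp: links_def)
  then have "y \<in> flags G" "gem_edge G c y \<in> K" "x = adj G c y"
    using graph_embeddingD[OF G, of x c] gem_edge_adj[OF G, of x c] by simp_all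
  then show "(y, x) \<in> links G K" unfolding links_def by blast
qed

lemma component_of_eq:
  assumes "graph_embedding G" and "y \<in> component_of G K z"
  shows "component_of G K y = component_of G K z"
proof -
  have "(z, y) \<in> (links G K)\<^sup>*" "(y, z) \<in> (links G K)\<^sup>*"
    using assms(2) sym_rtrancl[OF sym_links[OF assms(1)]] by (auto simp: component_of_def dest: symD)
  then show ?thesis by (auto simp: component_of_def intro: rtrancl_trans)
qed

lemma adj_in_component_of_iff:
  assumes G: "graph_embedding G" and z: "z \<in> flags G" and K: "gem_edge G c z \<in> K"
  shows "adj G c z \<in> component_of G K x \<longleftrightarrow> z \<in> component_of G K x"
proof -
  have "(z, adj G c z) \<in> links G K" using z K by (auto simp: links_def)
  then have "adj G c z \<in> component_of G K z" by (auto simp: component_of_def)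
  then show ?thesis
    using component_of_eq[OF G] component_of_refl by metis
qed

lemma gem_edge_in_gem_edges: "x \<in> flags G \<Longrightarrow> gem_edge G c x \<in> gem_edges G"
  by (auto simp: gem_edges_def)

lemma gem_edge_in_coloured_edges:
  "x \<in> flags G \<Longrightarrow> c \<in> C \<Longrightarrow> gem_edge G c x \<in> coloured_edges G C"
  by (auto simp: coloured_edges_def gem_edges_def gem_edge_def)

text \<open>Connectedness as it is used below: a closed set absorbs the component of any of its
  flags, and that component is everything.\<close>

lemma gem_connected:
  assumes G: "graph_embedding G" and "S \<subseteq> flags G" and "S \<noteq> {}"
    and closed: "\<And>z c. z \<in> S \<Longrightarrow> adj G c z \<in> S"
  shows "S = flags G"
proof -
  obtain x where x: "x \<in> S" using assms(3) by blast
  have "component_of G (gem_edges G) x \<in> gem_components G (gem_edges G)"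
    using x assms(2) by (auto simp: gem_components_def)
  then have "component_of G (gem_edges G) x = flags G"
    using G by (simp add: graph_embedding_def)
  moreover have "component_of G (gem_edges G) x \<subseteq> S"
    using x closed by (rule component_of_least)
  ultimately show ?thesis using assms(2) by blast
qed

section \<open>Narrow cuts and the parity of their boundary\<close>

text \<open>A yellow gem edge leaving \<open>A\<close> is represented by its end in
  \<open>A\<close>, so that parity arguments can count flags. By
  \<open>inj_on_gem_edge_yellow_boundary\<close>, distinct flags stand for distinct gem
  edges.\<close>

definition yellow_boundary :: "'a gem \<Rightarrow> 'a set \<Rightarrow> 'a set" where
  "yellow_boundary G A = {x \<in> A. adj G Yellow x \<notin> A}"

lemma yellow_boundary_subset: "yellow_boundary G A \<subseteq> A"
  by (auto simp: yellow_boundary_def)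

text \<open>The involution of colour \<open>c\<close> pairs up all of \<open>A\<close>, and the
  yellow one pairs up the flags whose yellow gem edge stays in \<open>A\<close>. The boundary is the
  difference of these two even sets.\<close>

lemma even_yellow_boundary:
  assumes G: "graph_embedding G" and A: "A \<subseteq> flags G" and closed: "\<And>x. x \<in> A \<Longrightarrow> adj G c x \<in> A"
  shows "even (card (yellow_boundary G A))"
proof -
  have fin: "finite A" using finite_flags[OF G] A by (rule finite_subset[rotated])
  have "even (card A)"
    using fin by (rule even_card_involution[where h = "adj G c"])
      (use closed graph_embeddingD[OF G] A in blast)
  moreover have "even (card (A - yellow_boundary G A))"
    using graph_embeddingD[OF G, of _ Yellow] A fin
    by (intro even_card_involution[where h = "adj G Yellow"]) (auto simp: yellow_boundary_def)
  moreover have "card A = card (A - yellow_boundary G A) + card (yellow_boundary G A)"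
    using fin yellow_boundary_subset[of G A]
    by (metis card_Diff_subset card_mono finite_subset le_add_diff_inverse2)
  ultimately show ?thesis by simp
qed

lemma inj_on_gem_edge_yellow_boundary:
  assumes "graph_embedding G" and "A \<subseteq> flags G"
  shows "inj_on (gem_edge G Yellow) (yellow_boundary G A)"
proof (rule inj_onI)
  fix x y
  assume x: "x \<in> yellow_boundary G A" and y: "y \<in> yellow_boundary G A"
    and "gem_edge G Yellow x = gem_edge G Yellow y"
  moreover have "x \<in> flags G" using x assms(2) by (auto simp: yellow_boundary_def)
  ultimately show "x = y"
    using gem_edge_eq_iff[OF assms(1)] by (auto simp: yellow_boundary_def)
qed

text \<open>Red and blue enter symmetrically, so exchanging them on some or all edge bigons
  preserves the notion. The bound is an inequality because this form passes easily to components
  inside a cut and to complements.\<close>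

definition narrow_cut :: "'a gem \<Rightarrow> 'a set \<Rightarrow> bool" where
  "narrow_cut G A \<longleftrightarrow> A \<subseteq> flags G \<and> A \<noteq> {} \<and> A \<noteq> flags G \<and>
     (\<forall>x\<in>A. adj G Red x \<in> A \<and> adj G Blue x \<in> A) \<and> card (yellow_boundary G A) \<le> 2"

lemma card_yellow_boundary_narrow_cut:
  assumes G: "graph_embedding G" and A: "narrow_cut G A"
  shows "card (yellow_boundary G A) = 2"
proof -
  have sub: "A \<subseteq> flags G" and ne: "A \<noteq> {}" "A \<noteq> flags G"
    and closed: "\<And>x. x \<in> A \<Longrightarrow> adj G Red x \<in> A \<and> adj G Blue x \<in> A"
    and le: "card (yellow_boundary G A) \<le> 2"
    using A by (auto simp: narrow_cut_def)
  have "yellow_boundary G A \<noteq> {}"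
  proof
    assume "yellow_boundary G A = {}"
    then have "adj G c x \<in> A" if "x \<in> A" for c x
      using closed[OF that] that by (cases c) (auto simp: yellow_boundary_def)
    then show False using gem_connected[OF G sub ne(1)] ne(2) by blast
  qed
  moreover have "finite (yellow_boundary G A)"
    using finite_flags[OF G] sub yellow_boundary_subset by (meson finite_subset)
  ultimately have "card (yellow_boundary G A) \<noteq> 0" by simp
  moreover have "even (card (yellow_boundary G A))"
    using even_yellow_boundary[OF G sub, of Red] closed by blast
  ultimately show ?thesis using le by presburger
qed

text \<open>The same yellow gem edges leave both sides; the complement sees them from their other
  ends.\<close>

lemma narrow_cut_Compl:
  assumes G: "graph_embedding G" and A: "narrow_cut G A"
  shows "narrow_cut G (flags G - A)"
    and "yellow_boundary G (flags G - A) = adj G Yellow ` yellow_boundary G A"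
proof -
  have sub: "A \<subseteq> flags G" and ne: "A \<noteq> {}" "A \<noteq> flags G"
    and closed: "\<And>x. x \<in> A \<Longrightarrow> adj G Red x \<in> A \<and> adj G Blue x \<in> A"
    using A by (auto simp: narrow_cut_def)
  note inv = graph_embeddingD[OF G]
  show bd: "yellow_boundary G (flags G - A) = adj G Yellow ` yellow_boundary G A"
  proof (intro set_eqI iffI)
    fix x assume "x \<in> yellow_boundary G (flags G - A)"
    then have x: "x \<in> flags G" "x \<notin> A" "adj G Yellow x \<in> A"
      using inv(1)[of x Yellow] by (auto simp: yellow_boundary_def)
    then have "adj G Yellow x \<in> yellow_boundary G A"
      using inv(3)[of x Yellow] by (auto simp: yellow_boundary_def)
    then show "x \<in> adj G Yellow ` yellow_boundary G A"
      using inv(3)[OF x(1), of Yellow] by (metis imageI)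
  qed (use sub inv in \<open>auto simp: yellow_boundary_def\<close>)
  have "card (yellow_boundary G (flags G - A)) \<le> card (yellow_boundary G A)"
    unfolding bd using finite_flags[OF G] sub yellow_boundary_subset
    by (meson card_image_le finite_subset)
  moreover have "adj G c x \<notin> A" if "x \<in> flags G - A" "c = Red \<or> c = Blue" for c x
    using closed[of "adj G c x"] inv(3)[of x c] that by auto
  ultimately show "narrow_cut G (flags G - A)"
    using A inv(1) by (auto simp: narrow_cut_def)
qed

text \<open>A union of edge bigons might fall apart once the cut edges are deleted. That it does not
  is what yields exactly two components in a separating vertex/face pair.\<close>

lemma component_of_narrow_cut:
  assumes G: "graph_embedding G" and A: "narrow_cut G A" and z: "z \<in> A"
  shows "component_of G (gem_edges G - gem_edge G Yellow ` yellow_boundary G A) z = A"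
    (is "component_of G ?K z = A")
proof -
  have sub: "A \<subseteq> flags G" and closed: "\<And>x. x \<in> A \<Longrightarrow> adj G Red x \<in> A \<and> adj G Blue x \<in> A"
    using A by (auto simp: narrow_cut_def)
  \<comment> \<open>The other end of a deleted gem edge lies outside \<open>A\<close>, so within
    \<open>A\<close> only the boundary flags lose their yellow neighbour.\<close>
  have in_K: "gem_edge G c x \<in> ?K \<longleftrightarrow> c \<noteq> Yellow \<or> x \<notin> yellow_boundary G A"
    if x: "x \<in> A" for x c
  proof -
    have "x \<in> flags G" using x sub by blast
    then have "gem_edge G c x \<in> gem_edge G Yellow ` yellow_boundary G A \<longleftrightarrow>
      c = Yellow \<and> x \<in> yellow_boundary G A"
      using gem_edge_eq_iff[OF G] graph_embeddingD(3)[OF G] x by (auto simp: yellow_boundary_def)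
    then show ?thesis using gem_edge_in_gem_edges[OF \<open>x \<in> flags G\<close>, of c] by blast
  qed
  have below: "component_of G ?K y \<subseteq> A" if "y \<in> A" for y
  proof (rule component_of_least[OF that])
    fix x c assume x: "x \<in> A" and "gem_edge G c x \<in> ?K"
    then have "c \<noteq> Yellow \<or> x \<notin> yellow_boundary G A" using in_K by blast
    then show "adj G c x \<in> A"
      using closed[OF x] x by (cases c) (auto simp: yellow_boundary_def)
  qed
  \<comment> \<open>By parity, every component of \<open>A\<close> contains both ends of the cut, so there is only one.\<close>
  have bd: "yellow_boundary G A \<subseteq> component_of G ?K y" if y: "y \<in> A" for y
  proof -
    let ?S = "component_of G ?K y"
    have S: "?S \<subseteq> flags G" "?S \<noteq> {}" "?S \<noteq> flags G"
      using below[OF y] sub A component_of_refl[of y G ?K] by (auto simp: narrow_cut_def)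
    have step: "adj G c x \<in> ?S" if "x \<in> ?S" "c \<noteq> Yellow \<or> x \<notin> yellow_boundary G A" for c x
    proof -
      have "x \<in> A" using below[OF y] that(1) by blast
      then show ?thesis
        using adj_in_component_of_iff[OF G, of x c ?K y] in_K[of x c] sub that by blast
    qed
    \<comment> \<open>A yellow gem edge that stays in \<open>A\<close> is not deleted, hence cannot
      leave the component.\<close>
    have sb: "yellow_boundary G ?S \<subseteq> yellow_boundary G A"
      using step by (auto simp: yellow_boundary_def[of G ?S])
    have fin: "finite (yellow_boundary G A)"
      using finite_flags[OF G] sub yellow_boundary_subset by (meson finite_subset)
    have "card (yellow_boundary G ?S) \<le> 2"
      using card_mono[OF fin sb] A by (simp add: narrow_cut_def)
    then have "narrow_cut G ?S"
      using S step by (simp add: narrow_cut_def)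
    then have "card (yellow_boundary G ?S) = card (yellow_boundary G A)"
      using card_yellow_boundary_narrow_cut[OF G] A by simp
    then have "yellow_boundary G ?S = yellow_boundary G A"
      using card_subset_eq[OF fin sb] by blast
    then show ?thesis using yellow_boundary_subset by metis
  qed
  have "yellow_boundary G A \<noteq> {}"
    using card_yellow_boundary_narrow_cut[OF G A] by auto
  then obtain a where a: "a \<in> yellow_boundary G A" by blast
  have eq_a: "component_of G ?K y = component_of G ?K a" if "y \<in> A" for y
    using component_of_eq[OF G, of a ?K y] bd[OF that] a by blast
  have "y \<in> component_of G ?K z" if "y \<in> A" for y
    using component_of_refl[of y G ?K] unfolding eq_a[OF that] eq_a[OF z] .
  then show ?thesis using below[OF z] by blast
qed

section \<open>Narrow cuts and separating vertex/face pairs\<close>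

text \<open>The part of \<open>A\<close> on the bigon is closed under colour \<open>c\<close>, so
  evenly many yellow gem edges leave it. The bigon is closed under yellow, so these are precisely
  the cut edges lying on it; one of the two forces the other. Red gives the vertex and blue the
  face.\<close>

lemma bigon_contains_yellow_boundary:
  assumes G: "graph_embedding G" and A: "narrow_cut G A" and c: "c = Red \<or> c = Blue"
    and a: "a \<in> yellow_boundary G A"
  shows "yellow_boundary G A \<subseteq> component_of G (coloured_edges G {c, Yellow}) a"
proof -
  let ?v = "component_of G (coloured_edges G {c, Yellow}) a"
  have sub: "A \<subseteq> flags G" and closed: "\<And>x. x \<in> A \<Longrightarrow> adj G Red x \<in> A \<and> adj G Blue x \<in> A"
    using A by (auto simp: narrow_cut_def)
  have adj: "adj G d x \<in> ?v \<longleftrightarrow> x \<in> ?v" if "x \<in> flags G" "d \<in> {c, Yellow}" for d x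
    using that by (intro adj_in_component_of_iff[OF G] gem_edge_in_coloured_edges)
  have "even (card (yellow_boundary G (A \<inter> ?v)))"
  proof (rule even_yellow_boundary[OF G])
    show "A \<inter> ?v \<subseteq> flags G" using sub by blast
    show "adj G c x \<in> A \<inter> ?v" if "x \<in> A \<inter> ?v" for x
      using that adj[of x c] closed[of x] c sub by auto
  qed
  moreover have "yellow_boundary G (A \<inter> ?v) = yellow_boundary G A \<inter> ?v"
    using sub adj[of _ Yellow] by (auto simp: yellow_boundary_def)
  ultimately have ev: "even (card (yellow_boundary G A \<inter> ?v))" by simp
  have fin: "finite (yellow_boundary G A)"
    using finite_flags[OF G] sub yellow_boundary_subset by (meson finite_subset)
  moreover have "yellow_boundary G A \<inter> ?v \<noteq> {}"
    using a component_of_refl by (metis IntI empty_iff)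
  ultimately have "card (yellow_boundary G A \<inter> ?v) \<noteq> 0" by simp
  with ev have "card (yellow_boundary G A \<inter> ?v) \<ge> 2" by presburger
  then have "card (yellow_boundary G A \<inter> ?v) \<ge> card (yellow_boundary G A)"
    by (simp add: card_yellow_boundary_narrow_cut[OF G A])
  then show ?thesis using card_seteq[OF fin Int_lower1] by blast
qed

lemma narrow_cut_contains_edge:
  assumes "narrow_cut G A"
  obtains e where "e \<in> edges G" "e \<subseteq> A"
proof -
  obtain z where z: "z \<in> A" "z \<in> flags G" using assms by (auto simp: narrow_cut_def)
  have "component_of G (coloured_edges G {Red, Blue}) z \<subseteq> A"
    using z(1) assms
    by (intro component_of_least) (auto simp: narrow_cut_def coloured_edges_def gem_edge_def)
  then show thesis
    using that z(2) by (auto simp: edges_def gem_components_def)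
qed

text \<open>The vertex and the face are the bigons through one boundary flag; both also contain the
  other boundary flag. The two sides are \<open>A\<close> and its complement.\<close>

lemma narrow_cut_imp_separating_vertex_face_pair:
  assumes G: "graph_embedding G" and A: "narrow_cut G A"
  shows "\<exists>v f. separating_vertex_face_pair G v f"
proof -
  let ?B = "flags G - A"
  have sub: "A \<subseteq> flags G" "A \<noteq> {}" "A \<noteq> flags G" using A by (auto simp: narrow_cut_def)
  obtain a b where bd: "yellow_boundary G A = {a, b}" and "a \<noteq> b"
    using card_yellow_boundary_narrow_cut[OF G A] by (meson card_2_iff)
  then have ab: "a \<in> A" "b \<in> A" "a \<in> flags G" "b \<in> flags G"
    using yellow_boundary_subset[of G A] sub by auto
  let ?v = "component_of G (coloured_edges G {Red, Yellow}) a"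
  let ?f = "component_of G (coloured_edges G {Blue, Yellow}) a"
  let ?K = "gem_edges G - {gem_edge G Yellow a, gem_edge G Yellow b}"
  have ne: "gem_edge G Yellow a \<noteq> gem_edge G Yellow b"
    using inj_on_gem_edge_yellow_boundary[OF G sub(1)] \<open>a \<noteq> b\<close> by (auto simp: bd)
  have ab_in: "a \<in> ?v \<inter> ?f" "b \<in> ?v \<inter> ?f"
    using bigon_contains_yellow_boundary[OF G A] bd by auto
  have vf: "?v \<in> vertices G" "?f \<in> faces G"
    using ab by (auto simp: vertices_def faces_def gem_components_def)
  have "gem_components G ?K = {A, ?B}"
  proof -
    note B = narrow_cut_Compl[OF G A]
    have "component_of G ?K z = A" if "z \<in> A" for z
      using component_of_narrow_cut[OF G A that] by (simp add: bd)
    \<comment> \<open>The boundary flags of the complement are the yellow neighbours of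
      \<open>a\<close> and \<open>b\<close>, so the same two gem edges are deleted.\<close>
    moreover have "component_of G ?K z = ?B" if "z \<in> ?B" for z
      using component_of_narrow_cut[OF G B(1) that] ab by (simp add: B(2) bd gem_edge_adj[OF G])
    moreover have "flags G = A \<union> ?B" "?B \<noteq> {}" using sub by auto
    ultimately show ?thesis
      using sub(2) unfolding gem_components_def by (auto simp: image_iff)
  qed
  moreover have "A \<noteq> ?B" using sub by blast
  moreover have "\<exists>e\<in>edges G. e \<subseteq> A" "\<exists>e\<in>edges G. e \<subseteq> ?B"
    using narrow_cut_contains_edge A narrow_cut_Compl(1)[OF G A] by metis+
  ultimately have sides: "\<exists>A B. A \<noteq> B \<and> gem_components G ?K = {A, B} \<and>
      (\<exists>e\<in>edges G. e \<subseteq> A) \<and> (\<exists>e\<in>edges G. e \<subseteq> B)"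
    by (intro exI conjI)
  have "separating_vertex_face_pair G ?v ?f"
    unfolding separating_vertex_face_pair_def
    by (intro conjI vf, rule exI[of _ a], rule exI[of _ b], intro conjI ab_in ne sides)
  then show ?thesis by blast
qed

lemma separating_vertex_face_pair_imp_narrow_cut:
  assumes G: "graph_embedding G" and "separating_vertex_face_pair G v f"
  shows "\<exists>A. narrow_cut G A"
proof -
  obtain x y A B where "A \<noteq> B"
    and comps: "gem_components G (gem_edges G - {gem_edge G Yellow x, gem_edge G Yellow y}) = {A, B}"
      (is "gem_components G ?K = _")
    using assms(2) unfolding separating_vertex_face_pair_def by (elim conjE bexE exE) rule
  \<comment> \<open>Two different components cannot both be the whole flag set; one that is not
    serves as the cut.\<close>
  then obtain S where S: "S \<in> gem_components G ?K" "S \<noteq> flags G" by (metis insertCI)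
  then obtain z where z: "z \<in> flags G" "S = component_of G ?K z"
    by (auto simp: gem_components_def)
  have sub: "S \<subseteq> flags G" using component_of_subset_flags[OF G z(1)] z(2) by simp
  have step: "adj G c u \<in> S" if "u \<in> S" "gem_edge G c u \<in> ?K" for u c
    using adj_in_component_of_iff[OF G _ that(2)] that(1) sub z(2) by blast
  have RB: "adj G c u \<in> S" if "u \<in> S" "c \<noteq> Yellow" for u c
    using step[OF that(1), of c] gem_edge_in_gem_edges[of u G c] sub that by (auto simp: gem_edge_def)
  have "gem_edge G Yellow ` yellow_boundary G S \<subseteq> {gem_edge G Yellow x, gem_edge G Yellow y}"
    using step gem_edge_in_gem_edges sub by (fastforce simp: yellow_boundary_def)
  from card_mono[OF _ this] have "card (gem_edge G Yellow ` yellow_boundary G S) \<le> 2"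
    by (simp add: card_insert_if split: if_splits)
  then have "card (yellow_boundary G S) \<le> 2"
    by (simp add: card_image[OF inj_on_gem_edge_yellow_boundary[OF G sub]])
  then have "narrow_cut G S"
    using sub S(2) RB z component_of_refl[of z G ?K] by (auto simp: narrow_cut_def)
  then show ?thesis by blast
qed

section \<open>Edge bigons and separating loops\<close>

text \<open>If the red and blue neighbours of \<open>x\<close> agreed, the bigon would have only two
  flags instead of four. Hence the listed flags are distinct and fill \<open>e\<close>, and the flag
  reached by blue and then red can only be the fourth one.\<close>

lemma edge_flags:
  assumes G: "graph_embedding G" and e: "e \<in> edges G" and x: "x \<in> e"
  shows "e = {x, adj G Red x, adj G Blue x, adj G Blue (adj G Red x)}"
    and "adj G Red (adj G Blue x) = adj G Blue (adj G Red x)"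
    and "e \<subseteq> flags G"
proof -
  obtain z where z: "z \<in> flags G" "e = component_of G (coloured_edges G {Red, Blue}) z"
    using e by (auto simp: edges_def gem_components_def)
  show sub: "e \<subseteq> flags G" using component_of_subset_flags[OF G z(1)] z(2) by simp
  have card_e: "card e = 4" using G e by (auto simp: graph_embedding_def)
  then have fin: "finite e" using card.infinite by fastforce
  let ?r = "adj G Red" and ?b = "adj G Blue"
  have closed: "?r y \<in> e" "?b y \<in> e" if "y \<in> e" for y
    using edge_closed[OF G e, of y] that sub by auto
  have inv: "?r y \<noteq> y" "?b y \<noteq> y" "?r (?r y) = y" "?b (?b y) = y" if "y \<in> e" for y
    using graph_embeddingD[OF G, of y] that sub by auto
  have rb: "?r x \<noteq> ?b x"
  proof
    assume eq: "?r x = ?b x"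
    have "component_of G (coloured_edges G {Red, Blue}) x \<subseteq> {x, ?r x}"
      using inv[OF x] eq
      by (intro component_of_least) (auto simp: coloured_edges_def gem_edge_def)
    then have "e \<subseteq> {x, ?r x}"
      using component_of_eq[OF G] x z(2) by simp
    from card_mono[OF _ this] show False
      using card_e by (simp add: card_insert_if split: if_splits)
  qed
  have "?b (?r x) \<noteq> x" "?b (?r x) \<noteq> ?b x"
    using inv(4)[OF closed(1)[OF x]] inv(1,4)[OF x] rb by metis+
  moreover have "?r (?b x) \<noteq> x" "?r (?b x) \<noteq> ?r x"
    using inv(3)[OF closed(2)[OF x]] inv(2,3)[OF x] rb by metis+
  ultimately have neq: "?b (?r x) \<notin> {x, ?r x, ?b x}" "?r (?b x) \<notin> {x, ?r x, ?b x}"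
    using inv(2)[OF closed(1)[OF x]] inv(1)[OF closed(2)[OF x]] by simp_all
  have "card {x, ?r x, ?b x, ?b (?r x)} = 4"
    using neq rb inv[OF x] by auto
  then show eq: "e = {x, ?r x, ?b x, ?b (?r x)}"
    using card_subset_eq[OF fin, of "{x, ?r x, ?b x, ?b (?r x)}"] card_e closed x by auto
  show "?r (?b x) = ?b (?r x)"
    using neq closed(1)[OF closed(2)[OF x]] eq by blast
qed

text \<open>Here \<open>S\<close> is one side of the surface cut along \<open>e\<close>, left only
  across red gem edges of \<open>e\<close>. It contains exactly one blue pair of flags of
  \<open>e\<close>. Removing this pair leaves a union of edge bigons, with exits only along the
  yellow gem edges of the pair.\<close>

lemma narrow_cut_beside_edge:
  assumes G: "graph_embedding G" and e: "e \<in> edges G" and S: "S \<subseteq> flags G"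
    and x: "x \<in> S \<inter> e" "adj G Red x \<notin> S"
    and blue_yellow: "\<And>z c. z \<in> flags G \<Longrightarrow> c \<noteq> Red \<Longrightarrow> adj G c z \<in> S \<longleftrightarrow> z \<in> S"
    and red: "\<And>z. z \<in> flags G - e \<Longrightarrow> adj G Red z \<in> S \<longleftrightarrow> z \<in> S"
    and ne: "\<not> S \<subseteq> e"
  shows "narrow_cut G (S - e)"
proof -
  note ef = edge_flags[OF G e, of x]
  have rx: "adj G Red x \<in> flags G" using graph_embeddingD(1)[OF G] x(1) S by blast
  \<comment> \<open>Blue steps do not change sides, so the red neighbour of \<open>x\<close> takes
    its own blue neighbour out of \<open>S\<close>.\<close>
  have Se: "S \<inter> e = {x, adj G Blue x}"
    using ef x blue_yellow[of x Blue] blue_yellow[OF rx, of Blue] by auto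
  have "yellow_boundary G (S - e) \<subseteq> adj G Yellow ` (S \<inter> e)"
  proof
    fix z assume "z \<in> yellow_boundary G (S - e)"
    then have z: "z \<in> S" "adj G Yellow z \<notin> S - e" by (auto simp: yellow_boundary_def)
    then have "adj G Yellow z \<in> S \<inter> e" using blue_yellow[of z Yellow] S by auto
    moreover have "z = adj G Yellow (adj G Yellow z)"
      using graph_embeddingD(3)[OF G] z(1) S by (metis subsetD)
    ultimately show "z \<in> adj G Yellow ` (S \<inter> e)" by blast
  qed
  then have "card (yellow_boundary G (S - e)) \<le> card (adj G Yellow ` (S \<inter> e))"
    unfolding Se by (intro card_mono) auto
  also have "\<dots> \<le> 2"
    unfolding Se by (simp add: card_insert_if)
  finally have "card (yellow_boundary G (S - e)) \<le> 2" .
  moreover have "adj G c z \<in> S - e" if "z \<in> S - e" "c = Red \<or> c = Blue" for c z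
    using that S blue_yellow[of z c] red[of z] edge_closed[OF G e, of z c] by auto
  moreover have "S - e \<noteq> flags G" using ef x by auto
  ultimately show ?thesis using S ne by (auto simp: narrow_cut_def)
qed

text \<open>Cutting along \<open>e\<close> leaves a proper component \<open>S\<close>. As there is a
  second edge, \<open>S\<close> or its complement has flags outside \<open>e\<close>, and
  \<open>narrow_cut_beside_edge\<close> applies to that side.\<close>

lemma separating_loop_imp_narrow_cut:
  assumes G: "graph_embedding G" and two: "card (edges G) \<ge> 2" and loop: "separating_loop G e"
  shows "\<exists>A. narrow_cut G A"
proof -
  let ?K = "gem_edges G - gem_edge G Red ` e"
  have e: "e \<in> edges G" and "card (gem_components G ?K) \<ge> 2"
    using loop by (auto simp: separating_loop_def is_loop_def)
  then obtain S where S: "S \<in> gem_components G ?K" "S \<noteq> flags G"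
    using card_mono[of "{flags G}" "gem_components G ?K"] by fastforce
  then obtain z0 where z0: "z0 \<in> flags G" "S = component_of G ?K z0"
    by (auto simp: gem_components_def)
  have sub: "S \<subseteq> flags G" using component_of_subset_flags[OF G z0(1)] z0(2) by simp
  have S_ne: "S \<noteq> {}" using component_of_refl z0(2) by fast
  have K: "gem_edge G c z \<in> ?K" if "z \<in> flags G" "c \<noteq> Red \<or> z \<notin> e" for c z
  proof -
    have "gem_edge G c z \<noteq> gem_edge G Red y" if "y \<in> e" for y
      using gem_edge_eq_iff[OF G \<open>z \<in> flags G\<close>, of c Red y] edge_closed[OF G e \<open>z \<in> flags G\<close>, of Red]
        that \<open>c \<noteq> Red \<or> z \<notin> e\<close> by auto
    then show ?thesis using gem_edge_in_gem_edges[OF that(1), of c] by blast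
  qed
  have adj: "adj G c z \<in> S \<longleftrightarrow> z \<in> S" if "z \<in> flags G" "c \<noteq> Red \<or> z \<notin> e" for c z
    unfolding z0(2) using adj_in_component_of_iff[OF G that(1) K[OF that]] .
  \<comment> \<open>Connectedness provides a gem edge leaving \<open>S\<close>; only red gem edges
    of \<open>e\<close> can do so.\<close>
  obtain x where x: "x \<in> S" "x \<in> e" "adj G Red x \<notin> S"
  proof -
    have "\<exists>z c. z \<in> S \<and> adj G c z \<notin> S"
      using gem_connected[OF G sub S_ne] S(2) by blast
    then obtain z c where z: "z \<in> S" "adj G c z \<notin> S" by blast
    then have "z \<in> e" "c = Red" using adj[of z c] sub by auto
    then show thesis using that z by blast
  qed
  let ?T = "flags G - S"
  note inv = graph_embeddingD[OF G]
  have xf: "x \<in> flags G" using x sub by blast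
  \<comment> \<open>Otherwise \<open>e\<close> would contain all flags and be the only edge.\<close>
  have "\<not> S \<subseteq> e \<or> \<not> ?T \<subseteq> e"
  proof (rule ccontr)
    assume "\<not> ?thesis"
    then have "flags G \<subseteq> e" by blast
    then have *: "flags G = e" using edge_flags(3)[OF G e x(2)] by blast
    have "edges G \<subseteq> {e}"
    proof
      fix e' assume e': "e' \<in> edges G"
      then have "card e' = 4" "card e = 4" using G e by (auto simp: graph_embedding_def)
      moreover obtain y where "y \<in> e'" using \<open>card e' = 4\<close> by fastforce
      then have "e' \<subseteq> e" using edge_flags(3)[OF G e'] * by blast
      ultimately have "e' = e"
        using card_subset_eq[of e e'] finite_flags[OF G] * by simp
      then show "e' \<in> {e}" by simp
    qed
    then have "card (edges G) \<le> 1" using card_mono[of "{e}"] by simp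
    then show False using two by simp
  qed
  then show ?thesis
  proof
    assume "\<not> S \<subseteq> e"
    then have "narrow_cut G (S - e)"
      using x adj by (intro narrow_cut_beside_edge[OF G e sub, of x]) auto
    then show ?thesis by blast
  next
    assume "\<not> ?T \<subseteq> e"
    \<comment> \<open>On the complementary side, the red neighbour of \<open>x\<close> takes over
      the role of \<open>x\<close>.\<close>
    moreover have "adj G Red x \<in> ?T \<inter> e"
      using x inv(1)[OF xf] edge_closed[OF G e xf, of Red] by auto
    moreover have "adj G Red (adj G Red x) \<notin> ?T" using inv(3)[OF xf] x by simp
    ultimately have "narrow_cut G (?T - e)"
      using adj inv(1) by (intro narrow_cut_beside_edge[OF G e, of _ "adj G Red x"]) auto
    then show ?thesis by blast
  qed
qed

section \<open>Invariance under geometric and partial duality\<close>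

text \<open>Exchanging red and blue permutes the colours within each of the two colour sets, so the
  links remain the same.\<close>

lemma links_dual:
  "links (dual G) (coloured_edges (dual G) {Red, Blue}) = links G (coloured_edges G {Red, Blue})"
  "links (dual G) (gem_edges (dual G)) = links G (gem_edges G)"
  by (auto simp: links_coloured_edges links_gem_edges ex_colour dual_def)

lemma edges_dual: "edges (dual G) = edges G"
  using links_dual(1)[of G] by (simp add: edges_def gem_components_def component_of_def dual_def)

lemma graph_embedding_dual:
  assumes "graph_embedding G"
  shows "graph_embedding (dual G)"
proof -
  have "gem_components (dual G) (gem_edges (dual G)) = gem_components G (gem_edges G)"
    using links_dual(2)[of G] by (simp add: gem_components_def component_of_def dual_def)
  then show ?thesis
    using assms edges_dual[of G] by (simp add: graph_embedding_def) (simp add: dual_def)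
qed

lemma narrow_cut_dual: "narrow_cut (dual G) A \<longleftrightarrow> narrow_cut G A"
  by (auto simp: narrow_cut_def yellow_boundary_def dual_def)

lemma narrow_cut_partial_dual:
  assumes G: "graph_embedding G" and D: "D \<subseteq> edges G" and A: "narrow_cut G A"
  shows "narrow_cut (partial_dual G D) A"
proof -
  have "yellow_boundary (partial_dual G D) A = yellow_boundary G A"
    by (simp add: yellow_boundary_def partial_dual_def)
  moreover have "adj (partial_dual G D) Red x \<in> A \<and> adj (partial_dual G D) Blue x \<in> A"
    if "x \<in> A" for x
    using adj_partial_dual(2,3)[OF G D, of x] A that by (auto simp: narrow_cut_def)
  ultimately show ?thesis using A by (simp add: narrow_cut_def)
qed

section \<open>Boundary walks of faces\<close>

text \<open>\<open>face_step\<close> permutes a finite set: two iterates coincide by the pigeonhole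
  principle, and injectivity cancels the common initial steps. Thus the \<open>LEAST\<close> in
  \<open>boundary_walk\<close> is attained.\<close>

lemma face_step_recurs:
  assumes G: "graph_embedding G" and x: "x \<in> flags G"
  shows "\<exists>k>0. (face_step G ^^ k) x = x"
proof -
  note inv = graph_embeddingD[OF G]
  have bij: "bij_betw (face_step G) (flags G) (flags G)"
  proof (rule bij_betw_byWitness[where f' = "\<lambda>x. adj G Blue (adj G Yellow x)"])
  qed (use inv in \<open>auto simp: face_step_def\<close>)
  have in_flags: "(face_step G ^^ k) x \<in> flags G" for k
    by (induction k) (use x inv(1) in \<open>auto simp: face_step_def\<close>)
  have "\<not> inj (\<lambda>k. (face_step G ^^ k) x)"
    using finite_flags[OF G] in_flags
    by (metis finite_imageD finite_subset image_subsetI infinite_UNIV_nat)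
  then obtain i j where "i < j" and eq: "(face_step G ^^ i) x = (face_step G ^^ j) x"
    unfolding inj_def by (metis linorder_neqE_nat)
  then have "(face_step G ^^ i) ((face_step G ^^ (j - i)) x) = (face_step G ^^ i) x"
    by (metis add_diff_inverse_nat comp_apply funpow_add less_imp_le not_less)
  then have "(face_step G ^^ (j - i)) x = x"
    using bij_betw_funpow[OF bij, of i] in_flags x by (metis bij_betw_def inj_onD)
  then show ?thesis using \<open>i < j\<close> zero_less_diff by blast
qed

lemma funpow_mod_period:
  assumes "(f ^^ p) x = x"
  shows "(f ^^ k) x = (f ^^ (k mod p)) x"
proof -
  have "(f ^^ (p * m)) x = x" for m
    by (induction m) (use assms in \<open>auto simp: funpow_add\<close>)
  then show ?thesis
    by (metis add.commute comp_apply funpow_add mult_div_mod_eq)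
qed

text \<open>The walk lists only one end of a yellow gem edge at each step, hence the added yellow
  neighbours. Blue sends the current flag to the yellow neighbour of the next one, and the yellow
  neighbour of the current flag to the previous one.\<close>

lemma face_component_subset:
  assumes G: "graph_embedding G" and x: "x \<in> flags G"
  shows "component_of G (coloured_edges G {Blue, Yellow}) x \<subseteq>
    {z. \<exists>k. z = (face_step G ^^ k) x \<or> z = adj G Yellow ((face_step G ^^ k) x)}" (is "_ \<subseteq> ?S")
proof (rule component_of_least)
  note inv = graph_embeddingD[OF G]
  show "x \<in> ?S" by (auto intro: exI[of _ 0])
  have in_flags: "(face_step G ^^ k) x \<in> flags G" for k
    by (induction k) (use x inv(1) in \<open>auto simp: face_step_def\<close>)
  obtain p where p: "p > 0" "(face_step G ^^ p) x = x" using face_step_recurs[OF G x] by blast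
  fix z c
  assume "z \<in> ?S" and "gem_edge G c z \<in> coloured_edges G {Blue, Yellow}"
  then obtain k where k: "z = (face_step G ^^ k) x \<or> z = adj G Yellow ((face_step G ^^ k) x)"
    and c: "c = Blue \<or> c = Yellow"
    by (auto simp: coloured_edges_def gem_edge_def)
  let ?u = "(face_step G ^^ k) x"
  from c show "adj G c z \<in> ?S"
  proof
    assume "c = Yellow"
    then have "adj G c z = adj G Yellow ?u \<or> adj G c z = ?u"
      using k inv(3)[OF in_flags] by auto
    then show ?thesis by blast
  next
    assume c: "c = Blue"
    from k show ?thesis
    proof
      assume "z = ?u"
      then have "adj G c z = adj G Yellow ((face_step G ^^ Suc k) x)"
        using c inv(1,3) in_flags by (simp add: face_step_def)
      then show ?thesis by blast
    next
      assume z: "z = adj G Yellow ?u"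
      \<comment> \<open>Adding a full period provides a previous step even when
        \<open>k = 0\<close>.\<close>
      have "?u = (face_step G ^^ (k + p)) x"
        using p(2) by (simp add: funpow_add)
      also have "\<dots> = face_step G ((face_step G ^^ (k + p - 1)) x)"
        using p(1) by (metis Suc_diff_1 add_gr_0 comp_apply funpow.simps(2))
      finally have "adj G c z = (face_step G ^^ (k + p - 1)) x"
        using z c inv(1,3) in_flags by (simp add: face_step_def)
      then show ?thesis by blast
    qed
  qed
qed

text \<open>The walk from \<open>x\<close> meets an end \<open>z\<close> of the yellow gem edge at
  \<open>y\<close>. Both ends lie on \<open>v\<close>, so \<open>v\<close> occurs at position 0 and
  again at the position of \<open>z\<close>.\<close>

lemma separating_vertex_face_pair_imp_not_closed_two_cell:
  assumes G: "graph_embedding G" and "separating_vertex_face_pair G v f"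
  shows "\<not> closed_two_cell G"
proof
  assume closed: "closed_two_cell G"
  obtain x y where v: "v \<in> vertices G" and f: "f \<in> faces G"
    and xy: "x \<in> v \<inter> f" "y \<in> v \<inter> f" "gem_edge G Yellow x \<noteq> gem_edge G Yellow y"
    using assms(2) by (auto simp: separating_vertex_face_pair_def)
  have eq: "C = component_of G K u \<and> u \<in> flags G"
    if "C \<in> gem_components G K" "u \<in> C" for C K u
    using that component_of_eq[OF G, of u K] component_of_subset_flags[OF G]
    by (fastforce simp: gem_components_def)
  have x: "x \<in> flags G" and y: "y \<in> flags G"
    using eq v xy unfolding vertices_def by blast+
  have v_eq: "v = vertex_of G u" if "u \<in> v" for u
    using eq v that unfolding vertices_def vertex_of_def by blast
  have "y \<in> component_of G (coloured_edges G {Blue, Yellow}) x"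
    using eq f xy unfolding faces_def by blast
  then obtain k where k: "y = (face_step G ^^ k) x \<or> y = adj G Yellow ((face_step G ^^ k) x)"
    using face_component_subset[OF G x] by blast
  define z where "z = (face_step G ^^ k) x"
  define p where "p = (LEAST k. k > 0 \<and> (face_step G ^^ k) x = x)"
  have p: "p > 0" "(face_step G ^^ p) x = x"
    using LeastI_ex[OF face_step_recurs[OF G x]] by (auto simp: p_def)
  have in_flags: "(face_step G ^^ k) x \<in> flags G" for k
    by (induction k) (use x graph_embeddingD(1)[OF G] in \<open>auto simp: face_step_def\<close>)
  have z: "z \<in> flags G" "gem_edge G Yellow z = gem_edge G Yellow y"
    using k in_flags gem_edge_adj[OF G in_flags] by (auto simp: z_def)
  have "z = y \<or> z = adj G Yellow y"
    using gem_edge_eq_iff[OF G y, of Yellow Yellow z] z(2) by simp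
  moreover have "adj G Yellow y \<in> v"
    using adj_in_component_of_iff[OF G y gem_edge_in_coloured_edges[OF y, of Yellow "{Red, Yellow}"]]
      v_eq[of y] xy(2) by (auto simp: vertex_of_def)
  ultimately have "z \<in> v" using xy(2) by blast
  then have same: "vertex_of G z = vertex_of G x" using v_eq xy(1) by blast
  \<comment> \<open>Reducing modulo the period places \<open>z\<close> within a single traversal of
    the face.\<close>
  define i where "i = k mod p"
  have i: "z = (face_step G ^^ i) x" "i < p"
    using funpow_mod_period[OF p(2)] p(1) by (auto simp: z_def i_def)
  \<comment> \<open>Position 0 would mean \<open>z = x\<close>, making the two corners
    coincide.\<close>
  have "i \<noteq> 0" using i(1) xy(3) z(2) by (intro notI) simp
  have "distinct (map (vertex_of G) (boundary_walk G x))"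
    using closed x by (simp add: closed_two_cell_def)
  then have "inj_on (\<lambda>i. vertex_of G ((face_step G ^^ i) x)) {0..<p}"
    by (simp add: boundary_walk_def p_def[symmetric] distinct_map comp_def)
  then have "i = 0"
    using inj_onD[of _ _ i 0] i same p(1) by fastforce
  then show False using \<open>i \<noteq> 0\<close> by blast
qed

theorem theorem3p7:
  fixes G :: "'a gem"
  assumes "graph_embedding G"
    and "card (edges G) \<ge> 2"
    and "(\<exists>v f. separating_vertex_face_pair G v f) \<or> (\<exists>e. separating_loop G e) \<or>
         (\<exists>e. separating_coloop G e)"
  shows "(\<forall>D\<subseteq>edges G. \<exists>v f. separating_vertex_face_pair (partial_dual G D) v f) \<and>
         (\<forall>D\<subseteq>edges G. \<not> closed_two_cell (partial_dual G D))"
proof -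
  note G = assms(1)
  \<comment> \<open>A coloop is handled as a loop of the dual, whose narrow cuts are those of
    \<open>G\<close>.\<close>
  have "\<exists>A. narrow_cut (dual G) A" if "separating_coloop G e" for e
    using that separating_loop_imp_narrow_cut[OF graph_embedding_dual[OF G], of e] assms(2)
    by (simp add: separating_coloop_def edges_dual)
  then obtain A where A: "narrow_cut G A"
    using assms(3) separating_vertex_face_pair_imp_narrow_cut[OF G]
      separating_loop_imp_narrow_cut[OF G assms(2)] narrow_cut_dual by blast
  have "\<exists>v f. separating_vertex_face_pair (partial_dual G D) v f" if D: "D \<subseteq> edges G" for D
    using narrow_cut_imp_separating_vertex_face_pair[OF graph_embedding_partial_dual[OF G D]]
      narrow_cut_partial_dual[OF G D A] by blast
  then show ?thesis
    using separating_vertex_face_pair_imp_not_closed_two_cell graph_embedding_partial_dual[OF G]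
    by blast
qed

end
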